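(* For every integer $n\geq2$, $$p_{n,n}(n)=p_{n,n-1}(n)=p(n)-1.$$
   Context: A partition of $n$ is a finite multiset of positive integers summing to $n$; $p(n)$ is the number of partitions of $n$. For positive integers $A,a$ and a partition $\pi$, $\mathrm{mex}_{A,a}(\pi)$ is the smallest element of $\{a,a+A,a+2A,\dots\}$ that is not a part of $\pi$. $p_{A,a}(n)$ is the number of partitions $\pi$ of $n$ with $\mathrm{mex}_{A,a}(\pi)\equiv a \pmod{2A}$. *)

theory Defs
  imports Main "HOL-Library.Multiset" "HOL-Number_Theory.Cong"
begin

definition partitions :: "nat \<Rightarrow> nat multiset set" where
  "partitions n = {\<pi>. (\<forall>k \<in># \<pi>. 0 < k) \<and> sum_mset \<pi> = n}"

definition num_partitions :: "nat \<Rightarrow> nat" where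
  "num_partitions n = card (partitions n)"

text \<open>Only meaningful for positive \<open>A\<close>: then the progression is infinite, while \<open>\<pi>\<close> is
  finite, so the least element exists.\<close>

definition mex :: "nat \<Rightarrow> nat \<Rightarrow> nat multiset \<Rightarrow> nat" where
  "mex A a \<pi> = (LEAST m. (\<exists>k. m = a + k * A) \<and> m \<notin># \<pi>)"

definition mex_partitions :: "nat \<Rightarrow> nat \<Rightarrow> nat \<Rightarrow> nat multiset set" where
  "mex_partitions A a n = {\<pi> \<in> partitions n. [mex A a \<pi> = a] (mod (2 * A))}"

definition num_mex_partitions :: "nat \<Rightarrow> nat \<Rightarrow> nat \<Rightarrow> nat" where
  "num_mex_partitions A a n = card (mex_partitions A a n)"

lemma finite_partitions: "finite (partitions n)"
proof (rule finite_subset)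
  show "partitions n \<subseteq> mset ` {xs. set xs \<subseteq> {..n} \<and> length xs \<le> n}"
  proof
    fix \<pi> assume "\<pi> \<in> partitions n"
    then have pos: "\<forall>k \<in># \<pi>. 0 < k" and s: "sum_mset \<pi> = n"
      by (auto simp: partitions_def)
    obtain xs where xs: "mset xs = \<pi>" using ex_mset by blast
    have sl: "sum_list xs = n" using s xs by (metis sum_mset_sum_list)
    have p: "\<forall>x \<in> set xs. 0 < x" using pos xs by auto
    have "set xs \<subseteq> {..n}" using sl member_le_sum_list by fastforce
    moreover have "length ys \<le> sum_list ys" if "\<forall>x \<in> set ys. 0 < x" for ys :: "nat list"
      using that by (induction ys) auto
    ultimately show "\<pi> \<in> mset ` {xs. set xs \<subseteq> {..n} \<and> length xs \<le> n}"
      using xs sl p by blast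
  qed
  show "finite (mset ` {xs. set xs \<subseteq> {..n} \<and> length xs \<le> n})"
    by (intro finite_imageI finite_lists_length_le) simp
qed

end

theory Submission imports Defs begin

text \<open>When \<open>n < a + A\<close>, the only element of \<open>{a, a + A, a + 2A, \<dots>}\<close> that can be a part of a
  partition of \<open>n\<close> is \<open>a\<close>. Hence the mex is \<open>a\<close> or \<open>a + A\<close>, and only the former is congruent to
  \<open>a\<close> modulo \<open>2A\<close>: the partitions not counted are those having \<open>a\<close> as a part. Deleting one such
  part shows that there are \<open>p(n - a)\<close> of them, and \<open>p(0) = p(1) = 1\<close>.\<close>

lemma part_le_sum_mset:
  fixes \<pi> :: "nat multiset"
  assumes "k \<in># \<pi>"
  shows "k \<le> sum_mset \<pi>"
  using multi_member_split[OF assms] by auto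

lemma mex_eq_first:
  assumes "a \<notin># \<pi>"
  shows "mex A a \<pi> = a"
  unfolding mex_def
proof (rule Least_equality)
  show "(\<exists>k. a = a + k * A) \<and> a \<notin># \<pi>"
    using assms by (auto intro: exI[of _ 0])
qed auto

lemma mex_eq_second:
  assumes "a \<in># \<pi>" "a + A \<notin># \<pi>"
  shows "mex A a \<pi> = a + A"
  unfolding mex_def
proof (rule Least_equality)
  show "(\<exists>k. a + A = a + k * A) \<and> a + A \<notin># \<pi>"
    using assms by (auto intro: exI[of _ 1])
next
  fix m assume "(\<exists>k. m = a + k * A) \<and> m \<notin># \<pi>"
  then obtain k where k: "m = a + k * A" "m \<notin># \<pi>" by blast
  with assms(1) have "k \<noteq> 0" by (intro notI) simp
  then show "a + A \<le> m" using k(1) by (cases k) auto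
qed

lemma mex_partitions_eq:
  assumes "0 < A" "n < a + A"
  shows "mex_partitions A a n = partitions n - {\<pi> \<in> partitions n. a \<in># \<pi>}"
proof -
  have "[mex A a \<pi> = a] (mod (2 * A)) \<longleftrightarrow> a \<notin># \<pi>" if "\<pi> \<in> partitions n" for \<pi>
  proof (cases "a \<in># \<pi>")
    case True
    \<comment> \<open>A part of \<open>\<pi>\<close> is at most \<open>n\<close>, and
      \<open>n < a + A\<close>.\<close>
    have "a + A \<notin># \<pi>"
      using that part_le_sum_mset[of "a + A" \<pi>] assms(2) by (auto simp: partitions_def)
    then have "mex A a \<pi> = a + A" by (rule mex_eq_second[OF True])
    \<comment> \<open>Cancelling \<open>a\<close> leaves \<open>A\<close> against \<open>0\<close>,
      and \<open>2 * A\<close> does not divide \<open>A\<close> because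
      \<open>0 < A < 2 * A\<close>.\<close>
    moreover have "\<not> [a + A = a] (mod (2 * A))"
      using assms(1) by (simp only: cong_add_lcancel_0_nat) (simp add: cong_def)
    ultimately show ?thesis using True by simp
  qed (simp add: mex_eq_first)
  then show ?thesis unfolding mex_partitions_def by blast
qed

text \<open>Deleting one copy of \<open>a\<close> undoes \<open>add_mset a\<close>. For the converse
  inclusion, \<open>0 < a\<close> keeps all parts positive and \<open>a \<le> n\<close> makes
  \<open>a + (n - a) = n\<close> hold despite truncated subtraction.\<close>

lemma partitions_containing:
  assumes "0 < a" "a \<le> n"
  shows "{\<pi> \<in> partitions n. a \<in># \<pi>} = add_mset a ` partitions (n - a)"
proof (intro equalityI subsetI)
  fix \<pi> assume \<pi>: "\<pi> \<in> {\<pi> \<in> partitions n. a \<in># \<pi>}"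
  then obtain \<rho> where "\<pi> = add_mset a \<rho>" by (auto dest: multi_member_split)
  with \<pi> show "\<pi> \<in> add_mset a ` partitions (n - a)" by (auto simp: partitions_def)
qed (use assms in \<open>auto simp: partitions_def\<close>)

text \<open>The complement has \<open>num_partitions (n - a)\<close> elements, since
  \<open>add_mset a\<close> is injective. Stating this as a sum avoids subtraction on
  \<open>nat\<close>.\<close>

lemma num_mex_partitions_add:
  assumes "0 < a" "a \<le> n" "0 < A" "n < a + A"
  shows "num_mex_partitions A a n + num_partitions (n - a) = num_partitions n"
proof -
  let ?P = "{\<pi> \<in> partitions n. a \<in># \<pi>}"
  have "card ?P = num_partitions (n - a)"
    by (simp add: partitions_containing[OF assms(1,2)] num_partitions_def card_image inj_on_def)
  moreover have "card (partitions n - ?P) = card (partitions n) - card ?P"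
    by (rule card_Diff_subset) (auto intro: finite_subset[OF _ finite_partitions])
  moreover have "card ?P \<le> card (partitions n)"
    by (rule card_mono[OF finite_partitions]) auto
  ultimately show ?thesis
    by (simp add: num_mex_partitions_def mex_partitions_eq[OF assms(3,4)] num_partitions_def)
qed

lemma num_partitions_0: "num_partitions 0 = 1"
proof -
  have "\<pi> = {#}" if "\<pi> \<in> partitions 0" for \<pi>
    using that by (cases \<pi>) (simp_all add: partitions_def)
  moreover have "{#} \<in> partitions 0" by (simp add: partitions_def)
  ultimately have "partitions 0 = {{#}}" by blast
  then show ?thesis by (simp add: num_partitions_def)
qed

lemma num_partitions_1: "num_partitions 1 = 1"
proof -
  \<comment> \<open>Once every partition of 1 is known to contain the part 1, deleting that part
    reduces the count to \<open>partitions 0\<close>.\<close>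
  have "1 \<in># \<pi>" if "\<pi> \<in> partitions 1" for \<pi>
  proof -
    from that have "\<pi> \<noteq> {#}" by (auto simp: partitions_def)
    then obtain k where "k \<in># \<pi>" by (rule multiset_nonemptyE)
    moreover have "0 < k" "k \<le> 1"
      using that \<open>k \<in># \<pi>\<close> part_le_sum_mset[of k \<pi>] by (simp_all add: partitions_def)
    then have "k = 1" by simp
    ultimately show ?thesis by simp
  qed
  then have "partitions 1 = {\<pi> \<in> partitions 1. 1 \<in># \<pi>}" by blast
  also have "\<dots> = add_mset 1 ` partitions 0"
    using partitions_containing[of 1 1] by simp
  finally show ?thesis
    using num_partitions_0 by (simp add: num_partitions_def card_image inj_on_def)
qed

theorem theorem5p3:
  fixes n :: nat
  assumes "n \<ge> 2"
  shows "num_mex_partitions n n n = num_mex_partitions n (n - 1) n \<and>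
         int (num_mex_partitions n (n - 1) n) = int (num_partitions n) - 1"
proof -
  have "num_mex_partitions n n n + 1 = num_partitions n"
    using num_mex_partitions_add[of n n n] assms by (simp add: num_partitions_0)
  \<comment> \<open>For \<open>a = n - 1\<close> the bound \<open>n \<ge> 2\<close> gives both
    \<open>0 < a\<close> and \<open>n < a + n\<close>; what remains after deleting \<open>a\<close>
    is a partition of 1.\<close>
  moreover have "n - (n - 1) = 1" using assms by simp
  then have "num_mex_partitions n (n - 1) n + 1 = num_partitions n"
    using num_mex_partitions_add[of "n - 1" n n] assms num_partitions_1 by simp
  ultimately show ?thesis by linarith
qed

end
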